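(* Let $P=(\mathcal{S},\vec{T}_U,\vec{T}_Q)$ and $P'=(\mathcal{S}',\vec{T}_U',\vec{T}_Q')$ be database-driven programs with the same number of update transactions and the same number of query transactions, corresponding transactions taking the same parameters. Suppose an oracle is available for proving any valid Hoare triple and any valid logical entailment (so that inductiveness and sufficiency are understood semantically). If $P\simeq P'$, then there exists a sufficient, inductive bisimulation invariant $\Phi$ for $P$ and $P'$.
   Context: A database-driven program is a triple $P=(\mathcal{S},\vec{T}_U,\vec{T}_Q)$. The schema $\mathcal{S}$ maps finitely many relation names $R$ to record types $\{a_1:\tau_1;\dots;a_n:\tau_n\}$. $\vec{T}_U=(U_1,\dots,U_m)$ is a list of update transactions $\lambda\vec v.\,U$ and $\vec{T}_Q=(Q_1,\dots,Q_l)$ a list of query transactions $\lambda\vec v.\,Q$, with $U ::= \mathtt{ins}(R,\{a_1:v_1,\dots,a_n:v_n\}) \mid \mathtt{del}(R,\phi)\mid \mathtt{upd}(R,\phi,a,v)\mid U;U$, $Q ::= R\mid \Pi_\psi(Q)\mid \sigma_\phi(Q)\mid Q\bowtie_\phi Q\mid Q\cup Q\mid Q-Q$, where $\psi$ is a nonempty list of attributes, $\phi$ is a boolean combination ($\wedge,\vee,\neg$) of atoms $a\odot a'$, $a\odot v$, $a\in Q$ with $\odot\in\{\le,<,=,\ne,>,\ge\}$, and $v$ ranges over parameter variables and constants. A database instance $\Delta$ maps each relation name to a finite list of tuples; a tuple is a finite map from attribute names to values, viewed as a list of (attribute, value) pairs. A valuation $\sigma$ maps parameter variables to values; $v[\sigma]$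 is the value of $v$. Semantics of updates: $[\![U_1;U_2]\!]_{\sigma,\Delta}=[\![U_2]\!]_{\sigma,[\![U_1]\!]_{\sigma,\Delta}}$; $\mathtt{ins}(R,t)$ appends the tuple $t[\sigma]$ to the end of $\Delta(R)$; $\mathtt{del}(R,\phi)$ replaces $\Delta(R)$ by the sublist (order preserved) of tuples $x$ with $[\![\phi]\!]_{\sigma,\Delta,x}$ false; $\mathtt{upd}(R,\phi,a,v)$ replaces $\Delta(R)$ by the list of tuples not satisfying $\phi$ (in order) followed by the list of tuples satisfying $\phi$ (in order), each with attribute $a$ set to $v[\sigma]$. Semantics of queries: $[\![R]\!]_{\sigma,\Delta}=\Delta(R)$; $\Pi_\psi$ restricts each tuple to the attributes in $\psi$; $\sigma_\phi$ keeps the tuples $x$ with $[\![\phi]\!]_{\sigma,\Delta,x}$ true; $Q_1\times Q_2$ lists, for each $y$ of $[\![Q_1]\!]$ in order and each $z$ of $[\![Q_2]\!]$ in order, the merged map $y\cup z$ (keys disjoint); $Q_1\bowtie_\phi Q_2=\sigma_\phi(Q_1\times Q_2)$; $\cup$ is list concatenation; $Q_1-Q_2$ starts from $[\![Q_1]\!]$ and, for each element $y$ of $[\![Q_2]\!]$ in order, deletes the first occurrence of $y$ (if any). Predicates on a tuple $x$: $a\odot a'$ compares $x(a),x(a')$; $a\odot v$ compares $x(a)$ with $v[\sigma]$; $a\in Q$ holds iff $x(a)$ occurs in the list of first values of the tuples of $[\![Q]\!]_{\sigma,\Delta}$; connectives are standard. An invocation sequence is $\omega=(i_1,\sigma_1);\dots;(i_n,\sigma_n)$,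 $n\ge1$, where for $j<n$, $i_j$ is the index of an update transaction and $\sigma_j$ a valuation of its parameters, and $i_n$ is the index of a query transaction with valuation $\sigma_n$. $[\![P]\!]_{\omega,\Delta}$ is obtained by applying $U_{i_1}$ under $\sigma_1$ to $\Delta$, then $U_{i_2}$ under $\sigma_2$, etc., yielding $\Delta''$, and returning the list obtained by mapping each tuple of $[\![Q_{i_n}]\!]_{\sigma_n,\Delta''}$ to its list of values (attribute names discarded). $[\![P]\!]_\omega=[\![P]\!]_{\omega,\Delta_\emptyset}$ where $\Delta_\emptyset$ maps every relation to the empty list. $P\simeq P'$ means $[\![P]\!]_\omega=[\![P']\!]_\omega$ for all $\omega$. A bisimulation invariant for $P,P'$ is a relation $\Phi$ between instances of $\mathcal{S}$ and instances of $\mathcal{S}'$ (corresponding parameters $\vec x$ of $U_i$/$Q_i$ and $\vec y$ of $U_i'$/$Q_i'$ are equated). $\Phi$ is inductive if (a) $\Phi$ holds of $(\Delta_\emptyset,\Delta'_\emptyset)$ and (b) for every $i$ the Hoare triple $\{\Phi\wedge\vec x=\vec y\}\,U_i;U_i'\,\{\Phi\}$ is valid, i.e. whenever $\Phi(\Delta,\Delta')$ and $\sigma$ is a valuation of the shared parameters, $\Phi([\![U_i]\!]_{\sigma,\Delta},[\![U_i']\!]_{\sigma,\Delta'})$. $\Phi$ is sufficient if for every query index $i$, $(\Phi\wedge\vec x=\vec y)\models Q_i=Q_i'$, i.e. whenever $\Phi(\Delta,\Delta')$ and $\sigma$ is a valuation of the parameters, the value lists of $[\![Q_i]\!]_{\sigma,\Delta}$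 and $[\![Q_i']\!]_{\sigma,\Delta'}$ coincide. *)

theory Defs
  imports "HOL-Library.DAList" "HOL-Library.Finite_Map"
begin

text \<open>
  Type variables: \<open>'r\<close> relation names, \<open>'a\<close> attribute names, \<open>'ty\<close> attribute types,
  \<open>'x\<close> parameter variables, \<open>'v\<close> values.
\<close>

type_synonym ('r, 'a, 'ty) schema = "('r, ('a, 'ty) fmap) fmap"

text \<open>
  A tuple is a finite map that also has an order of its columns, because the result of a query is
  read off as a list of values. The type \<open>alist\<close> of association lists with distinct keys is
  exactly this.
\<close>

type_synonym ('a, 'v) tuple = "('a, 'v) alist"

type_synonym ('r, 'a, 'v) db = "('r, ('a, 'v) tuple list) fmap"

type_synonym ('x, 'v) valuation = "'x \<rightharpoonup> 'v"


subsection \<open>Syntax\<close>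

datatype ('x, 'v) operand = Param 'x | Const 'v

datatype cmp = Le | Lt | Eq | Ne | Gt | Ge

text \<open>\<open>Proj a as Q\<close> is the projection of \<open>Q\<close> to the nonempty attribute list \<open>a # as\<close>.\<close>

datatype ('r, 'a, 'x, 'v) query =
    Rel 'r
  | Proj 'a "'a list" "('r, 'a, 'x, 'v) query"
  | Select "('r, 'a, 'x, 'v) pred" "('r, 'a, 'x, 'v) query"
  | Join "('r, 'a, 'x, 'v) pred" "('r, 'a, 'x, 'v) query" "('r, 'a, 'x, 'v) query"
  | Union "('r, 'a, 'x, 'v) query" "('r, 'a, 'x, 'v) query"
  | Diff "('r, 'a, 'x, 'v) query" "('r, 'a, 'x, 'v) query"
and ('r, 'a, 'x, 'v) pred =
    CmpAttr cmp 'a 'a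
  | CmpVal cmp 'a "('x, 'v) operand"
  | InQuery 'a "('r, 'a, 'x, 'v) query"
  | Conj "('r, 'a, 'x, 'v) pred" "('r, 'a, 'x, 'v) pred"
  | Disj "('r, 'a, 'x, 'v) pred" "('r, 'a, 'x, 'v) pred"
  | Neg "('r, 'a, 'x, 'v) pred"

datatype ('r, 'a, 'x, 'v) update =
    Ins 'r "('a, ('x, 'v) operand) alist"
  | Del 'r "('r, 'a, 'x, 'v) pred"
  | Upd 'r "('r, 'a, 'x, 'v) pred" 'a "('x, 'v) operand"
  | Seq "('r, 'a, 'x, 'v) update" "('r, 'a, 'x, 'v) update"

datatype ('x, 'b) transaction = Trans (params: "'x list") (body: 'b)

datatype ('r, 'a, 'ty, 'x, 'v) program = Program
  (schema_of: "('r, 'a, 'ty) schema")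
  (updates: "('x, ('r, 'a, 'x, 'v) update) transaction list")
  (queries: "('x, ('r, 'a, 'x, 'v) query) transaction list")


subsection \<open>Semantics\<close>

fun operand_val :: "('x, 'v) valuation \<Rightarrow> ('x, 'v) operand \<Rightarrow> 'v" where
  "operand_val \<sigma> (Param x) = the (\<sigma> x)"
| "operand_val \<sigma> (Const c) = c"

fun cmp_holds :: "cmp \<Rightarrow> 'v::linorder \<Rightarrow> 'v \<Rightarrow> bool" where
  "cmp_holds Le u w = (u \<le> w)"
| "cmp_holds Lt u w = (u < w)"
| "cmp_holds Eq u w = (u = w)"
| "cmp_holds Ne u w = (u \<noteq> w)"
| "cmp_holds Gt u w = (u > w)"
| "cmp_holds Ge u w = (u \<ge> w)"

definition tuple_values :: "('a, 'v) tuple \<Rightarrow> 'v list" where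
  "tuple_values t = map snd (DAList.impl_of t)"

text \<open>
  For tuples with disjoint keys the merge is the concatenation of the two lists. On a key clash the
  left tuple has priority, so that the operation is total.
\<close>

lift_definition merge_tuple :: "('a, 'v) tuple \<Rightarrow> ('a, 'v) tuple \<Rightarrow> ('a, 'v) tuple" is
  "\<lambda>y z. y @ filter (\<lambda>(a, v). a \<notin> fst ` set y) z"
  by (force simp: distinct_map_fst_filter)

definition restrict_tuple :: "'a set \<Rightarrow> ('a, 'v) tuple \<Rightarrow> ('a, 'v) tuple" where
  "restrict_tuple A t = DAList.filter (\<lambda>(a, v). a \<in> A) t"

definition product :: "('a, 'v) tuple list \<Rightarrow> ('a, 'v) tuple list \<Rightarrow> ('a, 'v) tuple list" where
  "product ys zs = [merge_tuple y z. y \<leftarrow> ys, z \<leftarrow> zs]"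

definition list_diff :: "'b list \<Rightarrow> 'b list \<Rightarrow> 'b list" where
  "list_diff xs ys = fold remove1 ys xs"

definition first_values :: "('a, 'v) tuple list \<Rightarrow> 'v list" where
  "first_values ts = [hd (tuple_values t). t \<leftarrow> ts, tuple_values t \<noteq> []]"

definition rel_tuples :: "('r, 'a, 'v) db \<Rightarrow> 'r \<Rightarrow> ('a, 'v) tuple list" where
  "rel_tuples \<Delta> R = (case fmlookup \<Delta> R of Some ts \<Rightarrow> ts | None \<Rightarrow> [])"

text \<open>An atom that mentions an attribute which the tuple does not have is false.\<close>

primrec eval_query ::
    "('x, 'v) valuation \<Rightarrow> ('r, 'a, 'v::linorder) db \<Rightarrow> ('r, 'a, 'x, 'v) query \<Rightarrow> ('a, 'v) tuple list"
  and eval_pred ::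
    "('x, 'v) valuation \<Rightarrow> ('r, 'a, 'v::linorder) db \<Rightarrow> ('r, 'a, 'x, 'v) pred \<Rightarrow> ('a, 'v) tuple \<Rightarrow> bool"
  where
  "eval_query \<sigma> \<Delta> (Rel R) = rel_tuples \<Delta> R"
| "eval_query \<sigma> \<Delta> (Proj a as Q) = map (restrict_tuple (set (a # as))) (eval_query \<sigma> \<Delta> Q)"
| "eval_query \<sigma> \<Delta> (Select \<phi> Q) = filter (eval_pred \<sigma> \<Delta> \<phi>) (eval_query \<sigma> \<Delta> Q)"
| "eval_query \<sigma> \<Delta> (Join \<phi> Q1 Q2) =
     filter (eval_pred \<sigma> \<Delta> \<phi>) (product (eval_query \<sigma> \<Delta> Q1) (eval_query \<sigma> \<Delta> Q2))"
| "eval_query \<sigma> \<Delta> (Union Q1 Q2) = eval_query \<sigma> \<Delta> Q1 @ eval_query \<sigma> \<Delta> Q2"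
| "eval_query \<sigma> \<Delta> (Diff Q1 Q2) = list_diff (eval_query \<sigma> \<Delta> Q1) (eval_query \<sigma> \<Delta> Q2)"
| "eval_pred \<sigma> \<Delta> (CmpAttr c a b) = (\<lambda>x. \<exists>u w. DAList.lookup x a = Some u \<and>
     DAList.lookup x b = Some w \<and> cmp_holds c u w)"
| "eval_pred \<sigma> \<Delta> (CmpVal c a v) = (\<lambda>x. \<exists>u. DAList.lookup x a = Some u \<and>
     cmp_holds c u (operand_val \<sigma> v))"
| "eval_pred \<sigma> \<Delta> (InQuery a Q) = (\<lambda>x. \<exists>u. DAList.lookup x a = Some u \<and>
     u \<in> set (first_values (eval_query \<sigma> \<Delta> Q)))"
| "eval_pred \<sigma> \<Delta> (Conj \<phi> \<psi>) = (\<lambda>x. eval_pred \<sigma> \<Delta> \<phi> x \<and> eval_pred \<sigma> \<Delta> \<psi> x)"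
| "eval_pred \<sigma> \<Delta> (Disj \<phi> \<psi>) = (\<lambda>x. eval_pred \<sigma> \<Delta> \<phi> x \<or> eval_pred \<sigma> \<Delta> \<psi> x)"
| "eval_pred \<sigma> \<Delta> (Neg \<phi>) = (\<lambda>x. \<not> eval_pred \<sigma> \<Delta> \<phi> x)"

text \<open>Modifying a relation name outside the domain of the instance has no effect.\<close>

definition modify_rel ::
    "'r \<Rightarrow> (('a, 'v) tuple list \<Rightarrow> ('a, 'v) tuple list) \<Rightarrow> ('r, 'a, 'v) db \<Rightarrow> ('r, 'a, 'v) db" where
  "modify_rel R f \<Delta> = fmmap_keys (\<lambda>R' ts. if R' = R then f ts else ts) \<Delta>"

primrec eval_update ::
    "('x, 'v) valuation \<Rightarrow> ('r, 'a, 'x, 'v::linorder) update \<Rightarrow> ('r, 'a, 'v) db \<Rightarrow> ('r, 'a, 'v) db" where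
  "eval_update \<sigma> (Ins R t) = (\<lambda>\<Delta>. modify_rel R (\<lambda>ts. ts @ [DAList.map (operand_val \<sigma>) t]) \<Delta>)"
| "eval_update \<sigma> (Del R \<phi>) = (\<lambda>\<Delta>. modify_rel R (filter (\<lambda>x. \<not> eval_pred \<sigma> \<Delta> \<phi> x)) \<Delta>)"
| "eval_update \<sigma> (Upd R \<phi> a v) = (\<lambda>\<Delta>. modify_rel R
     (\<lambda>ts. filter (\<lambda>x. \<not> eval_pred \<sigma> \<Delta> \<phi> x) ts @
       map (DAList.update a (operand_val \<sigma> v)) (filter (eval_pred \<sigma> \<Delta> \<phi>) ts)) \<Delta>)"
| "eval_update \<sigma> (Seq U1 U2) = (\<lambda>\<Delta>. eval_update \<sigma> U2 (eval_update \<sigma> U1 \<Delta>))"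

definition instance_of :: "('r, 'a, 'ty) schema \<Rightarrow> ('r, 'a, 'v) db \<Rightarrow> bool" where
  "instance_of S \<Delta> \<longleftrightarrow> fmdom \<Delta> = fmdom S"

definition empty_db :: "('r, 'a, 'ty) schema \<Rightarrow> ('r, 'a, 'v) db" where
  "empty_db S = fmmap (\<lambda>_. []) S"


subsection \<open>Invocation sequences and program equivalence\<close>

text \<open>
  An invocation sequence is split into the calls of updates, all but the last, and the final call
  of a query. Transactions are indexed from 0.
\<close>

type_synonym ('x, 'v) call = "nat \<times> ('x, 'v) valuation"

type_synonym ('x, 'v) invocation = "('x, 'v) call list \<times> ('x, 'v) call"

definition valuation_of :: "('x, 'b) transaction \<Rightarrow> ('x, 'v) valuation \<Rightarrow> bool" where
  "valuation_of T \<sigma> \<longleftrightarrow> dom \<sigma> = set (params T)"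

definition call_of :: "('x, 'b) transaction list \<Rightarrow> ('x, 'v) call \<Rightarrow> bool" where
  "call_of Ts = (\<lambda>(i, \<sigma>). i < length Ts \<and> valuation_of (Ts ! i) \<sigma>)"

definition invocation_of :: "('r, 'a, 'ty, 'x, 'v) program \<Rightarrow> ('x, 'v) invocation \<Rightarrow> bool" where
  "invocation_of P = (\<lambda>(us, q). (\<forall>u \<in> set us. call_of (updates P) u) \<and> call_of (queries P) q)"

definition run_update ::
    "('r, 'a, 'ty, 'x, 'v::linorder) program \<Rightarrow> nat \<Rightarrow> ('x, 'v) valuation \<Rightarrow>
      ('r, 'a, 'v) db \<Rightarrow> ('r, 'a, 'v) db" where
  "run_update P i \<sigma> \<Delta> = eval_update \<sigma> (body (updates P ! i)) \<Delta>"

definition run_query ::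
    "('r, 'a, 'ty, 'x, 'v::linorder) program \<Rightarrow> nat \<Rightarrow> ('x, 'v) valuation \<Rightarrow>
      ('r, 'a, 'v) db \<Rightarrow> 'v list list" where
  "run_query P i \<sigma> \<Delta> = map tuple_values (eval_query \<sigma> \<Delta> (body (queries P ! i)))"

definition run_from ::
    "('r, 'a, 'ty, 'x, 'v::linorder) program \<Rightarrow> ('x, 'v) invocation \<Rightarrow>
      ('r, 'a, 'v) db \<Rightarrow> 'v list list" where
  "run_from P = (\<lambda>(us, (i, \<sigma>)) \<Delta>. run_query P i \<sigma> (fold (\<lambda>(j, \<tau>). run_update P j \<tau>) us \<Delta>))"

definition run :: "('r, 'a, 'ty, 'x, 'v::linorder) program \<Rightarrow> ('x, 'v) invocation \<Rightarrow> 'v list list" where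
  "run P \<omega> = run_from P \<omega> (empty_db (schema_of P))"

definition same_interface ::
    "('r, 'a, 'ty, 'x, 'v) program \<Rightarrow> ('r2, 'a2, 'ty2, 'x, 'v) program \<Rightarrow> bool" where
  "same_interface P P' \<longleftrightarrow>
     list_all2 (\<lambda>T T'. params T = params T') (updates P) (updates P') \<and>
     list_all2 (\<lambda>T T'. params T = params T') (queries P) (queries P')"

text \<open>
  Equivalence is only meant for programs with the same interface, and these have the same
  invocation sequences.
\<close>

definition equivalent ::
    "('r, 'a, 'ty, 'x, 'v::linorder) program \<Rightarrow> ('r2, 'a2, 'ty2, 'x, 'v) program \<Rightarrow> bool"
    (infix "\<simeq>" 50) where
  "P \<simeq> P' \<longleftrightarrow> (\<forall>\<omega>. invocation_of P \<omega> \<longrightarrow> run P \<omega> = run P' \<omega>)"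


subsection \<open>Bisimulation invariants\<close>

definition bisim_invariant ::
    "('r, 'a, 'ty, 'x, 'v::linorder) program \<Rightarrow> ('r2, 'a2, 'ty2, 'x, 'v) program \<Rightarrow>
      (('r, 'a, 'v) db \<Rightarrow> ('r2, 'a2, 'v) db \<Rightarrow> bool) \<Rightarrow> bool" where
  "bisim_invariant P P' \<Phi> \<longleftrightarrow>
     (\<forall>\<Delta> \<Delta>'. \<Phi> \<Delta> \<Delta>' \<longrightarrow> instance_of (schema_of P) \<Delta> \<and> instance_of (schema_of P') \<Delta>')"

definition inductive_invariant ::
    "('r, 'a, 'ty, 'x, 'v::linorder) program \<Rightarrow> ('r2, 'a2, 'ty2, 'x, 'v) program \<Rightarrow>
      (('r, 'a, 'v) db \<Rightarrow> ('r2, 'a2, 'v) db \<Rightarrow> bool) \<Rightarrow> bool" where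
  "inductive_invariant P P' \<Phi> \<longleftrightarrow>
     \<Phi> (empty_db (schema_of P)) (empty_db (schema_of P')) \<and>
     (\<forall>i < length (updates P). \<forall>\<sigma> \<Delta> \<Delta>'.
        valuation_of (updates P ! i) \<sigma> \<longrightarrow> \<Phi> \<Delta> \<Delta>' \<longrightarrow>
        \<Phi> (run_update P i \<sigma> \<Delta>) (run_update P' i \<sigma> \<Delta>'))"

definition sufficient_invariant ::
    "('r, 'a, 'ty, 'x, 'v::linorder) program \<Rightarrow> ('r2, 'a2, 'ty2, 'x, 'v) program \<Rightarrow>
      (('r, 'a, 'v) db \<Rightarrow> ('r2, 'a2, 'v) db \<Rightarrow> bool) \<Rightarrow> bool" where
  "sufficient_invariant P P' \<Phi> \<longleftrightarrow>
     (\<forall>i < length (queries P). \<forall>\<sigma> \<Delta> \<Delta>'.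
        valuation_of (queries P ! i) \<sigma> \<longrightarrow> \<Phi> \<Delta> \<Delta>' \<longrightarrow>
        run_query P i \<sigma> \<Delta> = run_query P' i \<sigma> \<Delta>')"

end

theory Submission
  imports Defs
begin

text \<open>
  The invariant is joint reachability: \<open>\<Phi> \<Delta> \<Delta>'\<close> holds iff one sequence of update calls leads from
  the empty instances to \<open>\<Delta>\<close> in \<open>P\<close> and to \<open>\<Delta>'\<close> in \<open>P'\<close>. Extending the sequence by one call gives
  inductiveness, and completing it with a query call gives an invocation sequence, on which
  \<open>P \<simeq> P'\<close> yields sufficiency.
\<close>

text \<open>Isolates the instance on which the final query of an invocation is evaluated, so that
  the invariant can refer to it.\<close>

definition run_updates ::
    "('r, 'a, 'ty, 'x, 'v::linorder) program \<Rightarrow> ('x, 'v) call list \<Rightarrow> ('r, 'a, 'v) db" where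
  "run_updates P us = fold (\<lambda>(j, \<tau>). run_update P j \<tau>) us (empty_db (schema_of P))"

lemma run_updates_Nil: "run_updates P [] = empty_db (schema_of P)"
  by (simp add: run_updates_def)

lemma run_updates_snoc: "run_updates P (us @ [(i, \<sigma>)]) = run_update P i \<sigma> (run_updates P us)"
  by (simp add: run_updates_def)

lemma run_eq_run_query: "run P (us, i, \<sigma>) = run_query P i \<sigma> (run_updates P us)"
  by (simp add: run_def run_from_def run_updates_def)

lemma fmdom_modify_rel: "fmdom (modify_rel R f \<Delta>) = fmdom \<Delta>"
  by (simp add: modify_rel_def)

text \<open>Every basic update goes through \<open>modify_rel\<close>, which only maps over existing
  keys. The instance is generalized because in \<open>Seq\<close> the second update starts from the
  result of the first.\<close>

lemma fmdom_eval_update: "fmdom (eval_update \<sigma> U \<Delta>) = fmdom \<Delta>"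
  by (induction U arbitrary: \<Delta>) (simp_all add: fmdom_modify_rel)

lemma instance_of_run_updates: "instance_of (schema_of P) (run_updates P us)"
\<comment> \<open>Induction from the right end, because \<open>fold\<close> applies the last call of
  the list last.\<close>
proof (induction us rule: rev_induct)
  case Nil
  show ?case by (simp add: run_updates_Nil instance_of_def empty_db_def)
next
  case (snoc u us)
  then show ?case
    by (cases u) (simp add: run_updates_snoc instance_of_def run_update_def fmdom_eval_update)
qed

text \<open>Sharing \<open>us\<close> matters: pairing instances that are reachable separately would
  relate unrelated states and could break sufficiency. The condition on calls is the one that
  \<open>invocation_of P\<close> puts on the update part.\<close>

definition jointly_reachable ::
    "('r, 'a, 'ty, 'x, 'v::linorder) program \<Rightarrow> ('r2, 'a2, 'ty2, 'x, 'v) program \<Rightarrow>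
      ('r, 'a, 'v) db \<Rightarrow> ('r2, 'a2, 'v) db \<Rightarrow> bool" where
  "jointly_reachable P P' \<Delta> \<Delta>' \<longleftrightarrow>
     (\<exists>us. (\<forall>u \<in> set us. call_of (updates P) u) \<and> \<Delta> = run_updates P us \<and> \<Delta>' = run_updates P' us)"

lemma bisim_invariant_jointly_reachable: "bisim_invariant P P' (jointly_reachable P P')"
  by (auto simp: bisim_invariant_def jointly_reachable_def instance_of_run_updates)

lemma inductive_invariant_jointly_reachable:
  fixes P :: "('r, 'a, 'ty, 'x, 'v::linorder) program"
    and P' :: "('r2, 'a2, 'ty2, 'x, 'v) program"
  shows "inductive_invariant P P' (jointly_reachable P P')"
  unfolding inductive_invariant_def
proof (intro conjI allI impI)
  show "jointly_reachable P P' (empty_db (schema_of P)) (empty_db (schema_of P'))"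
    unfolding jointly_reachable_def by (intro exI[of _ "[]"]) (simp add: run_updates_Nil)
next
  fix i \<Delta> \<Delta>' and \<sigma> :: "('x, 'v) valuation"
  assume i: "i < length (updates P)" "valuation_of (updates P ! i) \<sigma>"
  assume "jointly_reachable P P' \<Delta> \<Delta>'"
  then obtain us where "\<forall>u \<in> set us. call_of (updates P) u"
    and "\<Delta> = run_updates P us" "\<Delta>' = run_updates P' us"
    by (auto simp: jointly_reachable_def)
  with i show "jointly_reachable P P' (run_update P i \<sigma> \<Delta>) (run_update P' i \<sigma> \<Delta>')"
    unfolding jointly_reachable_def
    by (intro exI[of _ "us @ [(i, \<sigma>)]"]) (auto simp: run_updates_snoc call_of_def)
qed

lemma sufficient_invariant_jointly_reachable:
  fixes P :: "('r, 'a, 'ty, 'x, 'v::linorder) program"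
    and P' :: "('r2, 'a2, 'ty2, 'x, 'v) program"
  assumes "P \<simeq> P'"
  shows "sufficient_invariant P P' (jointly_reachable P P')"
  unfolding sufficient_invariant_def
proof (intro allI impI)
  fix i \<Delta> \<Delta>' and \<sigma> :: "('x, 'v) valuation"
  assume i: "i < length (queries P)" "valuation_of (queries P ! i) \<sigma>"
  assume "jointly_reachable P P' \<Delta> \<Delta>'"
  then obtain us where us: "\<forall>u \<in> set us. call_of (updates P) u"
    and \<Delta>: "\<Delta> = run_updates P us" "\<Delta>' = run_updates P' us"
    by (auto simp: jointly_reachable_def)
  \<comment> \<open>The update history that witnesses reachability, closed by the query call under
    consideration, is an invocation to which equivalence applies.\<close>
  from i us have "invocation_of P (us, i, \<sigma>)"
    by (simp add: invocation_of_def call_of_def)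
  with assms have "run P (us, i, \<sigma>) = run P' (us, i, \<sigma>)"
    by (simp add: equivalent_def)
  then show "run_query P i \<sigma> \<Delta> = run_query P' i \<sigma> \<Delta>'"
    by (simp add: run_eq_run_query \<Delta>)
qed

theorem theorem4p4:
  fixes P :: "('r, 'a, 'ty, 'x, 'v::linorder) program"
    and P' :: "('r2, 'a2, 'ty2, 'x, 'v) program"
  assumes "same_interface P P'"
    and "P \<simeq> P'"
  shows "\<exists>\<Phi>. bisim_invariant P P' \<Phi> \<and> inductive_invariant P P' \<Phi> \<and> sufficient_invariant P P' \<Phi>"
  using bisim_invariant_jointly_reachable inductive_invariant_jointly_reachable
    sufficient_invariant_jointly_reachable[OF assms(2)]
  by blast

end
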